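(* Let $K$ be a field and let $f\colon\mathbb{N}\to\mathbb{N}$ be nondecreasing. For all natural numbers $d,l$ there exists a natural number $M$ such that for every sequence $I_0,\dots,I_M$ of monomial ideals in $K[X_d,\dots,X_0,Y]$ with $\mathrm{deg}(I_i)\le l+f(i)$ for all $i\le M$, there exist $i<j\le M$ with $I_i\supseteq I_j$.
   Context: A monomial in $K[X_d,\dots,X_0,Y]$ is a polynomial of the form $X_d^{i_d}\cdots X_0^{i_0}Y^j$; its degree is the total degree $i_d+\dots+i_0+j$. A monomial ideal is an ideal generated by monomials. The degree of a finite set $G$ of monomials is $\max\{\mathrm{deg}(m): m\in G\}$. The degree of a monomial ideal $I$ is $\mathrm{deg}(I)=\min\{\mathrm{deg}(G): G \text{ a finite set of monomials with } I=\langle G\rangle\}$. The paper assumes throughout that all parameter functions $f$ are nondecreasing. *)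

theory Defs
  imports "HOL-Library.Poly_Mapping" "HOL-Algebra.Ideal"
begin

text \<open>
  Exponent vectors are elements of \<open>var \<Rightarrow>\<^sub>0 nat\<close>, polynomials are elements of
  \<open>(var \<Rightarrow>\<^sub>0 nat) \<Rightarrow>\<^sub>0 'k\<close> with the convolution product of
  theory Poly_Mapping.  Here \<open>VX i\<close> stands for the variable \<open>X_i\<close>.
\<close>

datatype var = VX nat | VY

type_synonym expo = "var \<Rightarrow>\<^sub>0 nat"
type_synonym 'k mpoly = "expo \<Rightarrow>\<^sub>0 'k"

definition vars_upto :: "nat \<Rightarrow> var set" where
  "vars_upto d = insert VY (VX ` {..d})"

text \<open>The exponent vectors in the variables \<open>X_d, \<dots>, X_0, Y\<close>.\<close>

definition expos :: "nat \<Rightarrow> expo set" where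
  "expos d = {e. Poly_Mapping.keys e \<subseteq> vars_upto d}"

text \<open>The polynomial ring \<open>K[X_d, \<dots>, X_0, Y]\<close>.\<close>

definition mpoly_ring :: "nat \<Rightarrow> 'k::field mpoly ring" where
  "mpoly_ring d =
    \<lparr>carrier = {p. Poly_Mapping.keys p \<subseteq> expos d}, monoid.mult = (*), one = 1, zero = 0, add = (+)\<rparr>"

definition monomials :: "nat \<Rightarrow> 'k::field mpoly set" where
  "monomials d = (\<lambda>e. Poly_Mapping.single e 1) ` expos d"

definition expo_deg :: "expo \<Rightarrow> nat" where
  "expo_deg e = (\<Sum>v\<in>Poly_Mapping.keys e. Poly_Mapping.lookup e v)"

text \<open>Total degree, with value \<open>0\<close> for the zero polynomial.\<close>

definition total_deg :: "'k::field mpoly \<Rightarrow> nat" where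
  "total_deg p = Max (insert 0 (expo_deg ` Poly_Mapping.keys p))"

text \<open>
  The empty set, which generates the zero ideal, is given degree \<open>0\<close>.
\<close>

definition set_deg :: "'k::field mpoly set \<Rightarrow> nat" where
  "set_deg G = Max (insert 0 (total_deg ` G))"

definition monomial_ideal :: "nat \<Rightarrow> 'k::field mpoly set \<Rightarrow> bool" where
  "monomial_ideal d I \<longleftrightarrow> (\<exists>S \<subseteq> monomials d. I = Idl\<^bsub>mpoly_ring d\<^esub> S)"

text \<open>
  The minimum is attained for every monomial ideal, since monomial ideals are generated by
  finitely many monomials.
\<close>

definition ideal_deg :: "nat \<Rightarrow> 'k::field mpoly set \<Rightarrow> nat" where
  "ideal_deg d I =
    (LEAST n. \<exists>G. finite G \<and> G \<subseteq> monomials d \<and> I = Idl\<^bsub>mpoly_ring d\<^esub> G \<and> n = set_deg G)"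

lemma expos_zero: "0 \<in> expos d"
  by (simp add: expos_def)

lemma expos_add: "a \<in> expos d \<Longrightarrow> b \<in> expos d \<Longrightarrow> a + b \<in> expos d"
  unfolding expos_def using Poly_Mapping.keys_add[of a b] by auto

lemma mpoly_ring_cring: "cring (mpoly_ring d :: 'k::field mpoly ring)"
proof (rule cringI)
  show "abelian_group (mpoly_ring d :: 'k mpoly ring)"
  proof (rule abelian_groupI)
    fix x y :: "'k mpoly"
    assume "x \<in> carrier (mpoly_ring d)" "y \<in> carrier (mpoly_ring d)"
    then show "x \<oplus>\<^bsub>mpoly_ring d\<^esub> y \<in> carrier (mpoly_ring d)"
      using Poly_Mapping.keys_add[of x y] by (auto simp: mpoly_ring_def)
  next
    fix x :: "'k mpoly"
    assume "x \<in> carrier (mpoly_ring d)"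
    then show "\<exists>y\<in>carrier (mpoly_ring d). y \<oplus>\<^bsub>mpoly_ring d\<^esub> x = \<zero>\<^bsub>mpoly_ring d\<^esub>"
      by (intro bexI[of _ "- x"]) (auto simp: mpoly_ring_def)
  qed (auto simp: mpoly_ring_def algebra_simps)
  show "Group.comm_monoid (mpoly_ring d :: 'k mpoly ring)"
  proof (rule comm_monoidI)
    fix x y :: "'k mpoly"
    assume xy: "x \<in> carrier (mpoly_ring d)" "y \<in> carrier (mpoly_ring d)"
    show "x \<otimes>\<^bsub>mpoly_ring d\<^esub> y \<in> carrier (mpoly_ring d)"
    proof -
      have "Poly_Mapping.keys (x * y) \<subseteq> expos d"
      proof
        fix e assume "e \<in> Poly_Mapping.keys (x * y)"
        then obtain a b where "a \<in> Poly_Mapping.keys x" "b \<in> Poly_Mapping.keys y" "e = a + b"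
          using Poly_Mapping.keys_mult[of x y] by blast
        with xy show "e \<in> expos d" by (auto simp: mpoly_ring_def intro!: expos_add)
      qed
      then show ?thesis by (simp add: mpoly_ring_def)
    qed
  qed (auto simp: mpoly_ring_def algebra_simps expos_zero)
qed (auto simp: mpoly_ring_def algebra_simps)

end

theory Submission
  imports Defs "HOL-Library.Ramsey"
begin

text \<open>
  Suppose that no \<open>I\<^sub>j\<close> in an infinite sequence of monomial ideals is contained in an earlier
  \<open>I\<^sub>i\<close>, and pick monomials \<open>m\<^sub>i\<^sub>j \<in> I\<^sub>j - I\<^sub>i\<close> for \<open>i < j\<close>.  For \<open>i < j < k\<close> the monomial
  \<open>m\<^sub>i\<^sub>j\<close> lies in \<open>I\<^sub>j\<close> and \<open>m\<^sub>j\<^sub>k\<close> does not, so some exponent of \<open>m\<^sub>i\<^sub>j\<close> exceeds the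
  corresponding exponent of \<open>m\<^sub>j\<^sub>k\<close>.  Colouring triples by the variable where this happens,
  Ramsey's theorem gives \<open>h\<^sub>0 < h\<^sub>1 < \<dots>\<close> along which a single exponent of the
  \<open>m\<^bsub>h\<^sub>n h\<^sub>n\<^sub>+\<^sub>1\<^esub>\<close> decreases forever, which is absurd.  Applied to the ideals
  \<open>\<langle>s\<^sub>0, \<dots>, s\<^sub>n\<^sub>-\<^sub>1\<rangle>\<close>, the same argument shows that monomial ideals are finitely generated; hence
  there are only finitely many of bounded degree, and the bound \<open>M\<close> follows by compactness.
\<close>

section \<open>Compactness and Ramsey arguments\<close>

text \<open>Koenig's lemma in diagonal form: finitely many values per column let the pigeonhole
  principle thin the rows \<open>S M\<close> to infinite sets that agree on ever longer initial
  segments.\<close>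

lemma finite_branching_limit:
  fixes S :: "nat \<Rightarrow> nat \<Rightarrow> 'a"
  assumes fin: "\<And>n. finite ((\<lambda>M. S M n) ` {n..})"
  obtains J where "\<And>n. \<exists>M\<ge>n. \<forall>i\<le>n. J i = S M i"
proof -
  \<comment> \<open>All rows in \<open>N (Suc n)\<close> agree in column \<open>n\<close>. Keeping
    them in \<open>{n..}\<close> makes \<open>fin\<close> applicable and yields the bound on
    \<open>M\<close> at the end.\<close>
  have "\<exists>N. \<forall>n. infinite (N n) \<and> (N (Suc n) \<subseteq> N n \<and> N (Suc n) \<subseteq> {n..} \<and>
          (\<exists>x. \<forall>M\<in>N (Suc n). S M n = x))"
  proof (rule dependent_nat_choice)
    show "\<exists>N :: nat set. infinite N"
      by (rule exI[of _ UNIV]) simp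
  next
    fix N :: "nat set" and n
    assume "infinite N"
    then have inf: "infinite (N \<inter> {n..})"
      by (simp add: infinite_nat_iff_unbounded_le)
        (metis Int_iff atLeast_iff linorder_linear order_trans)
    have "finite ((\<lambda>M. S M n) ` (N \<inter> {n..}))"
      by (rule finite_subset[OF _ fin[of n]]) blast
    from pigeonhole_infinite[OF inf this] obtain a
      where "infinite {M \<in> N \<inter> {n..}. S M n = S a n}" by blast
    then show "\<exists>N'. infinite N' \<and> (N' \<subseteq> N \<and> N' \<subseteq> {n..} \<and> (\<exists>x. \<forall>M\<in>N'. S M n = x))"
      by (intro exI[of _ "{M \<in> N \<inter> {n..}. S M n = S a n}"]) auto
  qed
  then obtain N where N: "\<forall>n. infinite (N n) \<and> (N (Suc n) \<subseteq> N n \<and> N (Suc n) \<subseteq> {n..} \<and>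
          (\<exists>x. \<forall>M\<in>N (Suc n). S M n = x))" ..
  then have inf: "\<And>n. infinite (N n)" and sub: "\<And>n. N (Suc n) \<subseteq> N n"
    and ge: "\<And>n. N (Suc n) \<subseteq> {n..}" and ex: "\<And>n. \<exists>x. \<forall>M\<in>N (Suc n). S M n = x"
    by simp_all
  from ex obtain J where J: "\<And>n M. M \<in> N (Suc n) \<Longrightarrow> S M n = J n"
    by metis
  show thesis
  proof (rule that)
    fix n
    from inf[of "Suc n"] obtain M where M: "M \<in> N (Suc n)"
      using infinite_imp_nonempty by blast
    \<comment> \<open>The sets decrease, so this single row lies in \<open>N (Suc i)\<close> for
      every \<open>i \<le> n\<close>.\<close>
    have "J i = S M i" if "i \<le> n" for i
      using J[of M i] M lift_Suc_antimono_le[of N "Suc i" "Suc n"] sub that by auto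
    with M ge show "\<exists>M\<ge>n. \<forall>i\<le>n. J i = S M i" by blast
  qed
qed

text \<open>A Dickson-type lemma for families indexed by pairs, meant for the exponents of monomials
  witnessing that one ideal is not contained in another.\<close>

lemma pair_family_good_triple:
  fixes F :: "nat \<Rightarrow> nat \<Rightarrow> 'v \<Rightarrow> nat"
  assumes "finite V"
  obtains i j k where "i < j" "j < k" "\<forall>v\<in>V. F i j v \<le> F j k v"
proof (rule ccontr)
  assume "\<not> thesis"
  with that have bad: "\<And>i j k. i < j \<Longrightarrow> j < k \<Longrightarrow> \<exists>v\<in>V. F j k v < F i j v"
    by (meson not_le)
  obtain h :: "nat \<Rightarrow> 'v" where h: "h ` {..<card V} = V"
    using ex_bij_betw_nat_finite[OF assms] by (auto simp: bij_betw_def lessThan_atLeast0)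
  have "\<exists>c<card V. F j k (h c) < F i j (h c)" if "i < j" "j < k" for i j k
    using bad[OF that] h by (metis imageE lessThan_iff)
  then obtain C where C: "\<And>i j k. i < j \<Longrightarrow> j < k \<Longrightarrow>
      C i j k < card V \<and> F j k (h (C i j k)) < F i j (h (C i j k))"
    by metis
  \<comment> \<open>Ramsey's theorem colours sets, so sorting recovers the triple with
    \<open>i < j < k\<close>.\<close>
  define col where "col X = (let xs = sorted_list_of_set X in C (xs!0) (xs!1) (xs!2))" for X
  have col: "col {i, j, k} = C i j k" if "i < j" "j < k" for i j k
  proof -
    have "sorted_list_of_set {i, j, k} = [i, j, k]"
      using sorted_list_of_set.idem_if_sorted_distinct[of "[i, j, k]"] that by simp
    then show ?thesis by (simp add: col_def)
  qed
  have "col X < card V" if "finite X" "card X = 3" for X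
  proof -
    have "length (sorted_list_of_set X) = 3" using that by simp
    then obtain i j k where ijk: "sorted_list_of_set X = [i, j, k]"
      unfolding numeral_3_eq_3 length_Suc_conv by blast
    moreover have "sorted_wrt (<) (sorted_list_of_set X)"
      by (rule strict_sorted_list_of_set)
    ultimately have "i < j" "j < k" by auto
    then show ?thesis using C by (simp add: col_def ijk)
  qed
  then obtain Y c where Y: "infinite Y"
    and mono: "\<And>X. X \<subseteq> Y \<Longrightarrow> finite X \<Longrightarrow> card X = 3 \<Longrightarrow> col X = c"
    using Ramsey[of "UNIV :: nat set" 3 col "card V"] by auto
  define y where "y = enumerate Y"
  have y_less: "y n < y (Suc n)" for n
    using enumerate_step[OF Y] by (simp add: y_def)
  have y_in: "y n \<in> Y" for n
    using enumerate_in_set[OF Y] by (simp add: y_def)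
  \<comment> \<open>Consecutive pairs share an index, so colour \<open>c\<close> of three successive
    points says precisely that \<open>g\<close> drops.\<close>
  define g where "g n = F (y n) (y (Suc n)) (h c)" for n
  have "g (Suc n) < g n" for n
  proof -
    let ?i = "y n" and ?j = "y (Suc n)" and ?k = "y (Suc (Suc n))"
    have lt: "?i < ?j" "?j < ?k" by (rule y_less)+
    have "C ?i ?j ?k = c"
      using mono[of "{?i, ?j, ?k}"] col[OF lt] y_in lt by auto
    then show ?thesis using C[OF lt] by (auto simp: g_def)
  qed
  then show False
    using wf_less_than by (auto simp: wf_iff_no_infinite_down_chain)
qed

section \<open>Ideals generated by monomials\<close>

lemma carrier_mpoly_ring_monomials: "monomials d \<subseteq> carrier (mpoly_ring d)"
  by (auto simp: monomials_def mpoly_ring_def)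

lemma ideal_mpoly_ring_genideal:
  assumes "S \<subseteq> monomials d"
  shows "ideal (Idl\<^bsub>mpoly_ring d\<^esub> S) (mpoly_ring d :: 'k::field mpoly ring)"
    and "S \<subseteq> Idl\<^bsub>mpoly_ring d\<^esub> S"
proof -
  interpret cring "mpoly_ring d :: 'k mpoly ring" by (rule mpoly_ring_cring)
  from assms carrier_mpoly_ring_monomials have S: "S \<subseteq> carrier (mpoly_ring d)" by blast
  show "ideal (Idl\<^bsub>mpoly_ring d\<^esub> S) (mpoly_ring d)" by (rule genideal_ideal[OF S])
  show "S \<subseteq> Idl\<^bsub>mpoly_ring d\<^esub> S" by (rule genideal_self[OF S])
qed

lemma mpoly_ring_genideal_minimal:
  assumes "ideal J (mpoly_ring d :: 'k::field mpoly ring)" and "S \<subseteq> J"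
  shows "Idl\<^bsub>mpoly_ring d\<^esub> S \<subseteq> J"
  using assms ring.genideal_minimal cring.axioms(1)[OF mpoly_ring_cring] by blast

lemma monomial_ideal_is_ideal:
  "monomial_ideal d I \<Longrightarrow> ideal I (mpoly_ring d :: 'k::field mpoly ring)"
  unfolding monomial_ideal_def using ideal_mpoly_ring_genideal(1) by blast

text \<open>The monomials in \<open>I\<close> include a generating set of \<open>I\<close>, so a
  failed inclusion always has a monomial witness.\<close>

lemma monomial_ideal_subset_iff:
  fixes I J :: "'k::field mpoly set"
  assumes "monomial_ideal d I" and "ideal J (mpoly_ring d)"
  shows "I \<subseteq> J \<longleftrightarrow> I \<inter> monomials d \<subseteq> J"
proof
  assume *: "I \<inter> monomials d \<subseteq> J"
  from assms obtain S where S: "S \<subseteq> monomials d" and I: "I = Idl\<^bsub>mpoly_ring d\<^esub> S"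
    by (auto simp: monomial_ideal_def)
  have "S \<subseteq> J" using * S ideal_mpoly_ring_genideal(2)[OF S] I by blast
  then show "I \<subseteq> J" unfolding I by (rule mpoly_ring_genideal_minimal[OF assms(2)])
qed blast

lemma ideal_single_mono:
  fixes J :: "'k::field mpoly set"
  assumes J: "ideal J (mpoly_ring d)" and a: "Poly_Mapping.single a 1 \<in> J"
    and b: "b \<in> expos d"
    and le: "\<And>v. v \<in> vars_upto d \<Longrightarrow> Poly_Mapping.lookup a v \<le> Poly_Mapping.lookup b v" and a': "a \<in> expos d"
  shows "Poly_Mapping.single b 1 \<in> J"
proof -
  have "Poly_Mapping.lookup a v \<le> Poly_Mapping.lookup b v" for v
    using le[of v] a' by (cases "Poly_Mapping.lookup a v = 0") (auto simp: expos_def in_keys_iff subset_iff)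
  \<comment> \<open>Subtraction of exponents is truncated; it is exact here because \<open>a\<close>
    is below \<open>b\<close> in every variable.\<close>
  then have b_eq: "b = (b - a) + a"
    by (intro poly_mapping_eqI) (simp add: lookup_add lookup_minus)
  have "b - a \<in> expos d"
    using b by (auto simp: expos_def in_keys_iff lookup_minus)
  then have "(Poly_Mapping.single (b - a) 1 :: 'k mpoly) \<in> carrier (mpoly_ring d)"
    by (simp add: mpoly_ring_def)
  from ideal.I_l_closed[OF J a this]
  have "(Poly_Mapping.single (b - a) 1 * Poly_Mapping.single a 1 :: 'k mpoly) \<in> J"
    by (simp add: mpoly_ring_def)
  then show ?thesis by (simp add: mult_single b_eq[symmetric])
qed

lemma finite_vars_upto: "finite (vars_upto d)"
  by (simp add: vars_upto_def)

section \<open>Well-quasi-ordering and finite generation\<close>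

lemma monomial_ideals_good_pair:
  fixes I :: "nat \<Rightarrow> 'k::field mpoly set"
  assumes I: "\<And>i. monomial_ideal d (I i)"
  obtains i j where "i < j" "I j \<subseteq> I i"
proof (rule ccontr)
  assume "\<not> thesis"
  with that have "\<And>i j. i < j \<Longrightarrow> \<not> I j \<subseteq> I i"
    by blast
  then have "\<exists>e\<in>expos d. Poly_Mapping.single e 1 \<in> I j - I i" if "i < j" for i j
    using that monomial_ideal_subset_iff[OF I[of j] monomial_ideal_is_ideal[OF I[of i]]]
    by (fastforce simp: monomials_def)
  then obtain m where m: "\<And>i j. i < j \<Longrightarrow>
      m i j \<in> expos d \<and> Poly_Mapping.single (m i j) 1 \<in> I j - I i"
    by metis
  obtain i j k where ij: "i < j" and jk: "j < k"
    and le: "\<forall>v\<in>vars_upto d. Poly_Mapping.lookup (m i j) v \<le> Poly_Mapping.lookup (m j k) v"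
    using pair_family_good_triple[OF finite_vars_upto, where F = "\<lambda>i j. Poly_Mapping.lookup (m i j)"] by metis
  \<comment> \<open>The monomial with exponent \<open>m i j\<close> lies in \<open>I j\<close> and
    divides this one, which was chosen outside \<open>I j\<close>.\<close>
  have "Poly_Mapping.single (m j k) 1 \<in> I j"
    by (rule ideal_single_mono[OF monomial_ideal_is_ideal[OF I[of j]]])
      (use m[OF ij] m[OF jk] le in auto)
  with m[OF jk] show False by blast
qed

lemma monomial_ideal_finitely_generated:
  fixes I :: "'k::field mpoly set"
  assumes "monomial_ideal d I"
  obtains G where "finite G" "G \<subseteq> monomials d" "I = Idl\<^bsub>mpoly_ring d\<^esub> G"
proof (rule ccontr)
  assume "\<not> thesis"
  with that have no: "\<And>G. finite G \<Longrightarrow> G \<subseteq> monomials d \<Longrightarrow> I \<noteq> Idl\<^bsub>mpoly_ring d\<^esub> G"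
    by blast
  from assms obtain S where S: "S \<subseteq> monomials d" and I: "I = Idl\<^bsub>mpoly_ring d\<^esub> S"
    by (auto simp: monomial_ideal_def)
  \<comment> \<open>If a finite \<open>G \<subseteq> S\<close> captured all of \<open>S\<close>, it
    would generate \<open>I\<close>.\<close>
  have ex: "\<exists>s\<in>S. s \<notin> Idl\<^bsub>mpoly_ring d\<^esub> G" if G: "finite G" "G \<subseteq> S" for G
  proof (rule ccontr)
    assume "\<not> ?thesis"
    then have "S \<subseteq> Idl\<^bsub>mpoly_ring d\<^esub> G" by blast
    moreover have Gm: "G \<subseteq> monomials d" using G S by blast
    ultimately have "I \<subseteq> Idl\<^bsub>mpoly_ring d\<^esub> G"
      unfolding I by (intro mpoly_ring_genideal_minimal ideal_mpoly_ring_genideal(1))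
    moreover have "Idl\<^bsub>mpoly_ring d\<^esub> G \<subseteq> I"
      using G ideal_mpoly_ring_genideal[OF S] unfolding I
      by (intro mpoly_ring_genideal_minimal) auto
    ultimately show False using no[OF G(1) Gm] by blast
  qed
  have "\<exists>s. \<forall>n. (finite (s n) \<and> s n \<subseteq> S) \<and>
      (\<exists>x\<in>S. x \<notin> Idl\<^bsub>mpoly_ring d\<^esub> (s n) \<and> s (Suc n) = insert x (s n))"
  proof (rule dependent_nat_choice)
    fix G :: "'k mpoly set" and n :: nat
    assume G: "finite G \<and> G \<subseteq> S"
    with ex[of G] obtain x where "x \<in> S" "x \<notin> Idl\<^bsub>mpoly_ring d\<^esub> G" by blast
    with G show "\<exists>G'. (finite G' \<and> G' \<subseteq> S) \<and>
        (\<exists>x\<in>S. x \<notin> Idl\<^bsub>mpoly_ring d\<^esub> G \<and> G' = insert x G)"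
      by (intro exI[of _ "insert x G"]) auto
  qed auto
  then obtain s where s: "\<And>n. s n \<subseteq> S"
    and step: "\<And>n. \<exists>x\<in>S. x \<notin> Idl\<^bsub>mpoly_ring d\<^esub> (s n) \<and> s (Suc n) = insert x (s n)"
    by blast
  have sm: "s n \<subseteq> monomials d" for n using s S by blast
  obtain i j where ij: "i < j" and sub: "Idl\<^bsub>mpoly_ring d\<^esub> (s j) \<subseteq> Idl\<^bsub>mpoly_ring d\<^esub> (s i)"
    using monomial_ideals_good_pair[of d "\<lambda>n. Idl\<^bsub>mpoly_ring d\<^esub> (s n)"] sm
    unfolding monomial_ideal_def by metis
  from step[of i] obtain x where x: "x \<notin> Idl\<^bsub>mpoly_ring d\<^esub> (s i)" "x \<in> s (Suc i)" by blast
  have "s n \<subseteq> s (Suc n)" for n using step[of n] by blast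
  \<comment> \<open>The generator added at stage \<open>i\<close> is still in \<open>s j\<close>, so
    the good pair puts it into the ideal of \<open>s i\<close> that it was chosen to avoid.\<close>
  from lift_Suc_mono_le[of s, OF this, of "Suc i" j] ij have "s (Suc i) \<subseteq> s j" by simp
  with x sub ideal_mpoly_ring_genideal(2)[OF sm[of j]] show False by blast
qed

section \<open>Bounded degree and the uniform bound\<close>

lemma finite_expos_deg_le: "finite {e \<in> expos d. expo_deg e \<le> n}"
proof (rule finite_imageD)
  let ?B = "{f. \<forall>v. (v \<in> vars_upto d \<longrightarrow> f v \<in> {..n}) \<and> (v \<notin> vars_upto d \<longrightarrow> f v = 0)}"
  have le: "Poly_Mapping.lookup e v \<le> expo_deg e" for e v
    by (cases "v \<in> Poly_Mapping.keys e")
      (simp_all add: expo_deg_def member_le_sum not_in_keys_iff_lookup_eq_zero)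
  have "Poly_Mapping.lookup ` {e \<in> expos d. expo_deg e \<le> n} \<subseteq> ?B"
  proof (intro subsetI CollectI allI conjI impI; elim imageE CollectE conjE)
    fix g e v
    assume g: "g = Poly_Mapping.lookup e" and e: "e \<in> expos d" "expo_deg e \<le> n"
    show "g v \<in> {..n}" using le[of e v] e(2) g by simp
    show "g v = 0" if "v \<notin> vars_upto d"
      using e(1) that g by (auto simp: expos_def in_keys_iff)
  qed
  moreover have "finite ?B"
    by (rule finite_set_of_finite_funs) (simp_all add: finite_vars_upto)
  ultimately show "finite (Poly_Mapping.lookup ` {e \<in> expos d. expo_deg e \<le> n})"
    by (rule finite_subset)
qed (auto intro: inj_onI poly_mapping_eqI)

text \<open>Each such ideal is generated by a subset of the finite set of monomials of degree at
  most \<open>n\<close>.\<close>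

lemma finite_monomial_ideals_deg_le:
  "finite {I :: 'k::field mpoly set. monomial_ideal d I \<and> ideal_deg d I \<le> n}"
proof (rule finite_subset)
  let ?m = "\<lambda>e. Poly_Mapping.single e 1 :: 'k mpoly"
  let ?E = "{e \<in> expos d. expo_deg e \<le> n}"
  show "{I :: 'k mpoly set. monomial_ideal d I \<and> ideal_deg d I \<le> n}
      \<subseteq> (\<lambda>G. Idl\<^bsub>mpoly_ring d\<^esub> G) ` Pow (?m ` ?E)"
  proof safe
    fix I :: "'k mpoly set"
    assume I: "monomial_ideal d I" and le: "ideal_deg d I \<le> n"
    let ?P = "\<lambda>n. \<exists>G. finite G \<and> G \<subseteq> monomials d \<and> I = Idl\<^bsub>mpoly_ring d\<^esub> G \<and> n = set_deg G"
    from I have "\<exists>n. ?P n" using monomial_ideal_finitely_generated[of d I] by metis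
    \<comment> \<open>Finite generation ensures that the \<open>LEAST\<close> in
      \<open>ideal_deg\<close> is attained by an actual generating set.\<close>
    then have "?P (ideal_deg d I)" unfolding ideal_deg_def by (rule LeastI_ex)
    then obtain G where G: "finite G" "G \<subseteq> monomials d" "I = Idl\<^bsub>mpoly_ring d\<^esub> G"
      "ideal_deg d I = set_deg G" by blast
    have "G \<subseteq> ?m ` ?E"
    proof
      fix p assume p: "p \<in> G"
      with G obtain e where e: "e \<in> expos d" "p = ?m e" by (auto simp: monomials_def)
      have "total_deg p \<le> set_deg G" using p G(1) by (simp add: set_deg_def)
      moreover have "total_deg p = expo_deg e" using e by (simp add: total_deg_def)
      ultimately show "p \<in> ?m ` ?E" using e le G(4) by auto
    qed
    with G show "I \<in> (\<lambda>G. Idl\<^bsub>mpoly_ring d\<^esub> G) ` Pow (?m ` ?E)" by blast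
  qed
  show "finite ((\<lambda>G. Idl\<^bsub>mpoly_ring d\<^esub> G) ` Pow (?m ` ?E))"
    using finite_expos_deg_le by simp
qed

theorem mainTheorem2:
  fixes f :: "nat \<Rightarrow> nat"
  assumes "mono f"
  shows "\<forall>d l. \<exists>M. \<forall>I :: nat \<Rightarrow> 'k::field mpoly set.
    (\<forall>i\<le>M. monomial_ideal d (I i) \<and> ideal_deg d (I i) \<le> l + f i) \<longrightarrow>
    (\<exists>i j. i < j \<and> j \<le> M \<and> I j \<subseteq> I i)"
proof (intro allI, rule ccontr)
  fix d l
  assume "\<nexists>M. \<forall>I :: nat \<Rightarrow> 'k mpoly set.
    (\<forall>i\<le>M. monomial_ideal d (I i) \<and> ideal_deg d (I i) \<le> l + f i) \<longrightarrow>
    (\<exists>i j. i < j \<and> j \<le> M \<and> I j \<subseteq> I i)"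
  then have "\<forall>M. \<exists>I :: nat \<Rightarrow> 'k mpoly set.
    (\<forall>i\<le>M. monomial_ideal d (I i) \<and> ideal_deg d (I i) \<le> l + f i) \<and>
    \<not> (\<exists>i j. i < j \<and> j \<le> M \<and> I j \<subseteq> I i)"
    by (simp only: not_ex not_all not_imp simp_thms)
  then obtain S :: "nat \<Rightarrow> nat \<Rightarrow> 'k mpoly set"
    where S: "\<And>M i. i \<le> M \<Longrightarrow> monomial_ideal d (S M i) \<and> ideal_deg d (S M i) \<le> l + f i"
      and bad: "\<And>M i j. i < j \<Longrightarrow> j \<le> M \<Longrightarrow> \<not> S M j \<subseteq> S M i"
    by metis
  \<comment> \<open>The degree bound in column \<open>n\<close> is the same for all counterexamples
    \<open>S M\<close> with \<open>M \<ge> n\<close>.\<close>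
  have "finite ((\<lambda>M. S M n) ` {n..})" for n
    by (rule finite_subset[OF _ finite_monomial_ideals_deg_le[of d "l + f n"]]) (use S in auto)
  then obtain J where J: "\<And>n. \<exists>M\<ge>n. \<forall>i\<le>n. J i = S M i"
    by (rule finite_branching_limit) blast
  have "monomial_ideal d (J n)" for n
    using J[of n] S by force
  then obtain i j where ij: "i < j" and sub: "J j \<subseteq> J i"
    by (rule monomial_ideals_good_pair)
  \<comment> \<open>One finite counterexample agrees with the limit at both \<open>i\<close> and
    \<open>j\<close>, so it inherits the good pair.\<close>
  obtain M where "M \<ge> j" "J i = S M i" "J j = S M j"
    using J[of j] ij by (meson less_imp_le order_refl)
  with bad[OF ij, of M] sub show False by simp
qed

end
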